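(* Let $L$ be a lattice domain generated by principal elements. Then $L$ is a Dedekind lattice if and only if every nonzero principal element $x\ne 1$ of $L$ has a CPP-factorization.
   Context: A multiplicative lattice is an ordered commutative monoid $(L,\le,\cdot)$ such that $(L,\le)$ is a complete lattice with top element $1$ and bottom element $0$, $0\ne 1$; $x(\bigvee Y)=\bigvee_{y\in Y}xy$ for all $x\in L$, $Y\subseteq L$; and $x1=x$ for all $x\in L$. An element $c\in L$ is compact if $c\le\bigvee H$ with $H\subseteq L$ implies $c\le\bigvee F$ for some finite $F\subseteq H$. A subset $G\subseteq L$ generates $L$ if every element of $L$ is the join of some subset of $G$. Throughout, "lattice" means a multiplicative lattice $L$ such that (i) $1$ is compact, (ii) $L$ is generated by the set of its compact elements, (iii) every product of two compact elements is compact. An element $p\ne 1$ is prime if $xy\le p$ implies $x\le p$ or $y\le p$. $L$ is a lattice domain if it is a lattice and $0$ is prime. For $x,y\in L$, $(y:x)=\bigvee\{a\in L : ax\le y\}$. An element $m$ is meet-principal if $a\wedge bm=((a:m)\wedge b)m$ for all $a,b\in L$; an element $j$ is join-principal if $((aj\vee b):j)=a\vee(b:j)$ for all $a,b\in L$; an element is principal if it is both meet-principal and join-principal. A lattice domain $L$ generated by principal elements is a Dedekind lattice if every element of $L$ is a finite product of prime elements (with $1$ regarded as the empty product). Elements $a,b\in L$ are comaximal if $a\vee b=1$. For $a\in L\setminus\{1\}$, a CPP-factorization (comaximal prime power factorization) of $a$ is a factorization $a=a_1\cdots a_n$ ($n\ge1$) with $a_1,\dots,a_n\in L\setminus\{1\}$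 pairwise comaximal and each $a_i$ a power $p^k$ ($k\ge 1$) of a prime element $p$. *)

theory Defs
  imports Main
begin

text \<open>
  The carrier of a multiplicative lattice is the whole type. The top element of the lattice
  is the unit \<open>1\<close> of the monoid, and the bottom element, written \<open>0\<close> in the mathematical
  literature, is \<open>bot\<close>. Compatibility of the order with multiplication is not assumed
  separately because it follows from distributivity over joins (\<open>mult_lattice_mono\<close>).
\<close>

class multiplicative_lattice = complete_lattice + comm_monoid_mult +
  assumes top_eq_one: "top = 1"
    and bot_neq_one: "bot \<noteq> 1"
    and mult_Sup: "x * Sup Y = (SUP y\<in>Y. x * y)"

lemma mult_lattice_mono:
  fixes x y u v :: "'a::multiplicative_lattice"
  assumes "x \<le> y" "u \<le> v"
  shows "x * u \<le> y * v"
proof -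
  have right: "c * a \<le> c * b" if "a \<le> b" for a b c :: 'a
  proof -
    have "c * b = c * Sup {a, b}"
      using that by (simp add: sup.absorb2)
    also have "\<dots> = sup (c * a) (c * b)"
      by (simp only: mult_Sup) simp
    finally show ?thesis
      by (metis sup_ge1)
  qed
  have "x * u \<le> x * v" by (rule right[OF assms(2)])
  also have "\<dots> \<le> y * v" using right[OF assms(1), of v] by (simp add: mult.commute)
  finally show ?thesis .
qed

context complete_lattice
begin

definition compact_element :: "'a \<Rightarrow> bool" where
  "compact_element c \<longleftrightarrow>
     (\<forall>H. c \<le> Sup H \<longrightarrow> (\<exists>F. finite F \<and> F \<subseteq> H \<and> c \<le> Sup F))"

definition generating :: "'a set \<Rightarrow> bool" where
  "generating G \<longleftrightarrow> (\<forall>x. \<exists>S. S \<subseteq> G \<and> x = Sup S)"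

end

context multiplicative_lattice
begin

definition prime_element :: "'a \<Rightarrow> bool" where
  "prime_element p \<longleftrightarrow> p \<noteq> 1 \<and> (\<forall>x y. x * y \<le> p \<longrightarrow> x \<le> p \<or> y \<le> p)"

text \<open>\<open>residual y x\<close> is the residual usually written \<open>(y : x)\<close>.\<close>

definition residual :: "'a \<Rightarrow> 'a \<Rightarrow> 'a" where
  "residual y x = Sup {a. a * x \<le> y}"

definition meet_principal :: "'a \<Rightarrow> bool" where
  "meet_principal m \<longleftrightarrow> (\<forall>a b. inf a (b * m) = inf (residual a m) b * m)"

definition join_principal :: "'a \<Rightarrow> bool" where
  "join_principal j \<longleftrightarrow> (\<forall>a b. residual (sup (a * j) b) j = sup a (residual b j))"

definition principal_element :: "'a \<Rightarrow> bool" where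
  "principal_element x \<longleftrightarrow> meet_principal x \<and> join_principal x"

definition comaximal :: "'a \<Rightarrow> 'a \<Rightarrow> bool" where
  "comaximal a b \<longleftrightarrow> sup a b = 1"

end

class compactly_generated_mult_lattice = multiplicative_lattice +
  assumes compact_one: "compact_element 1"
    and compact_generating: "generating {c. compact_element c}"
    and compact_mult: "compact_element c \<Longrightarrow> compact_element d \<Longrightarrow> compact_element (c * d)"

class lattice_domain = compactly_generated_mult_lattice +
  assumes prime_bot: "prime_element bot"

text \<open>Being a Dedekind lattice is a property of the structure on the type \<open>'a\<close>.\<close>

definition dedekind_lattice :: "'a::lattice_domain itself \<Rightarrow> bool" where
  "dedekind_lattice _ \<longleftrightarrow>
     generating {x::'a. principal_element x} \<and>
     (\<forall>x::'a. \<exists>ps. (\<forall>p\<in>set ps. prime_element p) \<and> x = prod_list ps)"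

text \<open>
  Comaximality is symmetric, so \<open>sorted_wrt\<close> says that the factors at any two distinct
  positions of the list are comaximal; in particular no factor other than \<open>1\<close> can occur twice.
\<close>

definition cpp_factorization :: "'a::multiplicative_lattice list \<Rightarrow> 'a \<Rightarrow> bool" where
  "cpp_factorization as a \<longleftrightarrow>
     as \<noteq> [] \<and> a = prod_list as \<and> sorted_wrt comaximal as \<and>
     (\<forall>b\<in>set as. b \<noteq> 1 \<and> (\<exists>p k. prime_element p \<and> k \<ge> 1 \<and> b = p ^ k))"

end

theory Submission
  imports Defs "HOL-Library.Multiset"
begin

text \<open>
  The elements that matter are the nonzero principal ones. In a lattice domain they can be
  cancelled (\<open>join_principal_cancellable_mod\<close>), they are closed under products, and every factor
  of one is again one (\<open>principal_factor\<close>), so all prime factors of a nonzero principal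
  element are principal. Both directions then rest on one fact: under either hypothesis, a
  nonzero principal prime \<open>p\<close> is maximal.

  If nonzero principal elements have CPP-factorizations, take a principal \<open>a\<close> not below \<open>p\<close> and
  factor \<open>p * a\<close>. A nonzero principal prime contains no smaller one, so \<open>p\<close> itself
  is among the primes occurring; cancelling it shows that \<open>p\<close> occurs once and that \<open>a\<close> is the
  product of the other prime powers, all comaximal to \<open>p\<close>. Hence \<open>p\<close> and \<open>a\<close> are comaximal.
  Now an arbitrary nonzero element lies above a product of principal maximal primes, and
  these can be split off one at a time (\<open>prime_product_above_maximals\<close>).

  If \<open>L\<close> is Dedekind, maximality of \<open>p\<close> is the lattice version of the classical argument that
  an invertible prime ideal is maximal when all ideals are products of primes. Modulo \<open>p\<close>,
  factorizations into cancellable primes are unique, so the factorization of \<open>sup p (a * a)\<close>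
  is that of \<open>sup p a\<close> taken twice. Therefore \<open>p \<le> (sup p a) * (sup p a) \<le> sup (p * p) a\<close>,
  and dividing by \<open>p\<close> gives \<open>sup p a = 1\<close>. Distinct maximal elements are comaximal, so
  collecting equal primes in a prime factorization yields a CPP-factorization.
\<close>

section \<open>Arithmetic of multiplicative lattices\<close>

lemma mult_sup_distrib:
  fixes x :: "'a::multiplicative_lattice"
  shows "x * sup a b = sup (x * a) (x * b)"
  using mult_Sup[of x "{a, b}"] by simp

lemma sup_mult_distrib:
  fixes x :: "'a::multiplicative_lattice"
  shows "sup a b * x = sup (a * x) (b * x)"
  using mult_sup_distrib[of x a b] by (simp add: mult.commute)

lemma le_one: "(x::'a::multiplicative_lattice) \<le> 1"
  using top_greatest[of x] by (simp add: top_eq_one)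

lemma mult_le_left: "x * y \<le> (x::'a::multiplicative_lattice)"
  using mult_lattice_mono[OF order_refl le_one, of x y] by simp

lemma mult_le_right: "x * y \<le> (y::'a::multiplicative_lattice)"
  using mult_le_left[of y x] by (simp add: mult.commute)

lemma mult_bot: "x * bot = (bot::'a::multiplicative_lattice)"
  using mult_Sup[of x "{}"] by simp

lemma mult_eq_bot_iff: "x * y = bot \<longleftrightarrow> x = bot \<or> y = (bot::'a::lattice_domain)"
proof
  assume "x * y = bot"
  then have "x * y \<le> bot"
    by simp
  then show "x = bot \<or> y = bot"
    using prime_bot unfolding prime_element_def by (metis bot_unique)
qed (auto simp: mult_bot mult.commute[of bot])

lemma le_residual_iff:
  fixes c :: "'a::multiplicative_lattice"
  shows "c \<le> residual y x \<longleftrightarrow> c * x \<le> y"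
proof
  assume "c \<le> residual y x"
  then have "c * x \<le> residual y x * x"
    by (rule mult_lattice_mono) simp
  also have "\<dots> = (SUP a\<in>{a. a * x \<le> y}. x * a)"
    unfolding residual_def by (subst mult.commute) (rule mult_Sup)
  also have "\<dots> \<le> y"
    by (rule SUP_least) (simp add: mult.commute)
  finally show "c * x \<le> y" .
qed (simp add: residual_def Sup_upper)

lemma residual_mult_le:
  fixes x :: "'a::multiplicative_lattice"
  shows "residual y x * x \<le> y"
  using le_residual_iff by blast

lemma residual_mult:
  fixes x :: "'a::multiplicative_lattice"
  shows "residual y (x * z) = residual (residual y z) x"
proof -
  have "c \<le> residual y (x * z) \<longleftrightarrow> c \<le> residual (residual y z) x" for c
    by (simp add: le_residual_iff mult.assoc)
  then show ?thesis
    by (meson order.antisym order_refl)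
qed

lemma residual_prime:
  fixes p :: "'a::multiplicative_lattice"
  assumes "prime_element p" "\<not> a \<le> p"
  shows "residual p a = p"
proof (rule order.antisym)
  show "residual p a \<le> p"
    using assms residual_mult_le[of p a] unfolding prime_element_def by blast
qed (simp add: le_residual_iff mult_le_left)

section \<open>Products and comaximality\<close>

lemma comaximal_mult:
  fixes a :: "'a::multiplicative_lattice"
  assumes "comaximal a c" "comaximal b c"
  shows "comaximal (a * b) c"
proof -
  have "1 = sup a c * sup b c"
    using assms by (simp add: comaximal_def)
  also have "\<dots> \<le> sup (a * b) c"
    unfolding mult_sup_distrib sup_mult_distrib
    by (auto intro: le_supI1 le_supI2 mult_le_left mult_le_right)
  finally show ?thesis
    unfolding comaximal_def using le_one order.antisym by blast
qed

lemma comaximal_one: "comaximal 1 (c::'a::multiplicative_lattice)"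
  unfolding comaximal_def using le_one by (rule sup_absorb1)

lemma comaximal_sym: "comaximal a b \<Longrightarrow> comaximal b (a::'a::multiplicative_lattice)"
  by (simp add: comaximal_def sup_commute)

lemma comaximal_prod_list:
  fixes c :: "'a::multiplicative_lattice"
  assumes "\<And>a. a \<in> set as \<Longrightarrow> comaximal a c"
  shows "comaximal (prod_list as) c"
  using assms by (induction as) (auto simp: comaximal_one intro: comaximal_mult)

lemma comaximal_powers:
  fixes a :: "'a::multiplicative_lattice"
  assumes "comaximal a c"
  shows "comaximal (a ^ m) (c ^ n)"
proof -
  have left: "comaximal (b ^ k) d" if "comaximal b d" for b d :: 'a and k
    using that by (induction k) (auto simp: comaximal_one intro: comaximal_mult)
  show ?thesis
    by (rule left, rule comaximal_sym, rule left, rule comaximal_sym, rule assms)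
qed

lemma comaximal_mono:
  fixes a :: "'a::multiplicative_lattice"
  assumes "comaximal a c" "a \<le> b" "c \<le> d"
  shows "comaximal b d"
  using sup_mono[OF assms(2,3)] assms(1) le_one order.antisym
  unfolding comaximal_def by metis

lemma prime_prod_list_le:
  fixes p :: "'a::multiplicative_lattice"
  assumes "prime_element p" "prod_list as \<le> p"
  shows "\<exists>a\<in>set as. a \<le> p"
  using assms(2)
proof (induction as)
  case Nil
  then show ?case
    using assms(1) le_one order.antisym unfolding prime_element_def by fastforce
next
  case (Cons a as)
  then show ?case
    using assms(1) unfolding prime_element_def by auto
qed

lemma prime_power_le:
  fixes p :: "'a::multiplicative_lattice"
  assumes "prime_element p" "a ^ k \<le> p"
  shows "a \<le> p"
  using prime_prod_list_le[of p "replicate k a"] assms by (auto simp: prod_list_replicate)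

lemma prime_prod_mset_le:
  fixes p :: "'a::multiplicative_lattice"
  assumes "prime_element p" "prod_mset A \<le> p"
  shows "\<exists>a\<in>#A. a \<le> p"
  using prime_prod_list_le[of p] assms by (metis ex_mset prod_mset_prod_list set_mset_mset)

lemma prod_mset_le_member:
  fixes a :: "'a::multiplicative_lattice"
  assumes "a \<in># A"
  shows "prod_mset A \<le> a"
  using multi_member_split[OF assms] mult_le_left by auto

text \<open>For elements of a complete lattice with top \<open>1\<close> this is the usual notion of a coatom,
  phrased so that it can be used as a test for comaximality.\<close>

definition maximal_element :: "'a::multiplicative_lattice \<Rightarrow> bool" where
  "maximal_element p \<longleftrightarrow> p \<noteq> 1 \<and> (\<forall>a. \<not> a \<le> p \<longrightarrow> comaximal a p)"

lemma maximal_element_eq: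
  assumes "maximal_element p" "p \<le> q" "q \<noteq> 1"
  shows "q = p"
  using assms le_iff_sup comaximal_def unfolding maximal_element_def
  by (metis order.antisym sup_absorb1)

lemma maximal_element_generators:
  fixes p :: "'a::multiplicative_lattice"
  assumes gen: "generating G" and "p \<noteq> 1"
    and G: "\<And>a. a \<in> G \<Longrightarrow> \<not> a \<le> p \<Longrightarrow> comaximal a p"
  shows "maximal_element p"
  unfolding maximal_element_def
proof (intro conjI allI impI)
  fix b assume "\<not> b \<le> p"
  obtain S where S: "S \<subseteq> G" "b = Sup S"
    using gen unfolding generating_def by blast
  with \<open>\<not> b \<le> p\<close> obtain a where "a \<in> S" "\<not> a \<le> p"
    by (meson Sup_least)
  then show "comaximal b p"
    using G S by (metis Sup_upper comaximal_mono order_refl subsetD)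
qed fact

section \<open>Cancellation and principal elements\<close>

text \<open>Cancellability of the image of \<open>m\<close> in the quotient lattice of all elements above \<open>p\<close>,
  whose product is \<open>sup (x * y) p\<close>. The case \<open>p = bot\<close> is cancellability in the lattice itself.\<close>

definition cancellable_mod :: "'a::multiplicative_lattice \<Rightarrow> 'a \<Rightarrow> bool" where
  "cancellable_mod p m \<longleftrightarrow> (\<forall>x y. m * x \<le> sup (m * y) p \<longrightarrow> x \<le> sup y p)"

lemma cancellable_modD:
  "cancellable_mod p m \<Longrightarrow> m * x \<le> sup (m * y) p \<Longrightarrow> x \<le> sup y p"
  unfolding cancellable_mod_def by blast

lemma cancellable_le:
  "cancellable_mod bot m \<Longrightarrow> m * x \<le> m * y \<Longrightarrow> x \<le> y"
  using cancellable_modD[of bot m x y] by simp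

lemma cancellable_eq:
  "cancellable_mod bot m \<Longrightarrow> m * x = m * y \<Longrightarrow> x = y"
  by (simp add: cancellable_le order.antisym)

text \<open>Join-principality says \<open>residual (sup (y * m) p) m = sup y (residual p m)\<close>, and the last
  residual is \<open>p\<close> when \<open>p\<close> is prime.\<close>

lemma join_principal_cancellable_mod:
  assumes "join_principal m" "prime_element p" "\<not> m \<le> p"
  shows "cancellable_mod p m"
  unfolding cancellable_mod_def
proof (intro allI impI)
  fix x y assume "m * x \<le> sup (m * y) p"
  then have "x \<le> residual (sup (y * m) p) m"
    by (simp add: le_residual_iff mult.commute)
  also have "\<dots> = sup y (residual p m)"
    using assms(1) by (simp add: join_principal_def)
  finally show "x \<le> sup y p"
    using residual_prime[OF assms(2,3)] by simp
qed

text \<open>Multiplying \<open>m * x \<le> m * y\<close> (modulo \<open>p\<close>) by the cofactor \<open>z\<close> gives the same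
  inequality for \<open>c\<close>.\<close>

lemma cancellable_mod_factor:
  fixes p :: "'a::multiplicative_lattice"
  assumes c: "cancellable_mod p c" and mz: "sup (m * z) p = sup c p"
  shows "cancellable_mod p m"
  unfolding cancellable_mod_def
proof (intro allI impI)
  fix x y assume xy: "m * x \<le> sup (m * y) p"
  have "c * x \<le> sup (m * z) p * x"
    by (rule mult_lattice_mono) (simp_all add: mz)
  also have "\<dots> \<le> sup (z * (m * x)) p"
    unfolding sup_mult_distrib
    by (auto simp: ac_simps intro: le_supI1 le_supI2 mult_le_left mult_le_right)
  also have "\<dots> \<le> sup (z * sup (m * y) p) p"
    using mult_lattice_mono[OF order_refl xy] by (meson le_supI1 sup.bounded_iff sup_ge2)
  also have "\<dots> \<le> sup (sup (m * z) p * y) p"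
    unfolding sup_mult_distrib mult_sup_distrib
    by (auto simp: ac_simps intro: le_supI1 le_supI2 mult_le_left mult_le_right)
  also have "\<dots> \<le> sup (c * y) p"
    unfolding mz by (simp add: sup_mult_distrib mult_le_left le_supI2)
  finally show "x \<le> sup y p"
    by (rule cancellable_modD[OF c])
qed

lemma principal_cancellable:
  fixes m :: "'a::lattice_domain"
  assumes "principal_element m" "m \<noteq> bot"
  shows "cancellable_mod bot m"
  using assms join_principal_cancellable_mod[OF _ prime_bot] bot_unique
  unfolding principal_element_def by blast

lemma meet_principal_divides:
  fixes m :: "'a::multiplicative_lattice"
  assumes "meet_principal m" "a \<le> m"
  shows "a = residual a m * m"
proof -
  have "inf a (1 * m) = inf (residual a m) 1 * m"
    using assms(1) unfolding meet_principal_def by blast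
  then show ?thesis
    using assms(2) by (simp add: inf_absorb1 le_one)
qed

lemma principal_mult:
  fixes p :: "'a::multiplicative_lattice"
  assumes "principal_element p" "principal_element q"
  shows "principal_element (p * q)"
proof -
  have "meet_principal (p * q)"
    using assms unfolding principal_element_def meet_principal_def residual_mult
    by (metis mult.assoc)
  moreover have "join_principal (p * q)"
    using assms unfolding principal_element_def join_principal_def residual_mult
    by (metis mult.assoc)
  ultimately show ?thesis
    by (simp add: principal_element_def)
qed

text \<open>Multiplying by the cofactor \<open>y\<close> turns each defining identity for \<open>x\<close> into the one for
  \<open>x * y\<close>; the cofactor can then be cancelled.\<close>

lemma principal_factor:
  fixes x :: "'a::lattice_domain"
  assumes z: "principal_element (x * y)" and nz: "x * y \<noteq> bot"
  shows "principal_element x"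
proof -
  have cz: "cancellable_mod bot (x * y)"
    using principal_cancellable[OF z nz] .
  have "cancellable_mod bot y"
    by (rule cancellable_mod_factor[OF cz, of _ x]) (simp add: mult.commute)
  then have cy: "a \<le> b" if "a * y \<le> b * y" for a b
    using that cancellable_le[of y a b] by (simp add: mult.commute)
  have res: "residual (b * y) (x * y) \<le> residual b x" for b
    unfolding le_residual_iff
    by (rule cy) (use residual_mult_le[of "b * y" "x * y"] in \<open>simp add: mult.assoc\<close>)
  have "inf a (b * x) = inf (residual a x) b * x" for a b
  proof (rule order.antisym)
    have "inf a (b * x) * y \<le> inf (a * y) (b * (x * y))"
      using mult_lattice_mono[OF inf_le1 order_refl] mult_lattice_mono[OF inf_le2 order_refl]
      by (metis le_inf_iff mult.assoc)
    also have "\<dots> = inf (residual (a * y) (x * y)) b * (x * y)"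
      using z unfolding principal_element_def meet_principal_def by blast
    also have "\<dots> \<le> inf (residual a x) b * x * y"
      unfolding mult.assoc by (intro mult_lattice_mono inf_mono res order_refl)
    finally show "inf a (b * x) \<le> inf (residual a x) b * x"
      by (rule cy)
    have "inf (residual a x) b * x \<le> residual a x * x"
      by (intro mult_lattice_mono) auto
    then show "inf (residual a x) b * x \<le> inf a (b * x)"
      by (meson inf_le2 le_inf_iff mult_lattice_mono order.trans order_refl residual_mult_le)
  qed
  moreover have "residual (sup (a * x) b) x = sup a (residual b x)" for a b
  proof (rule order.antisym)
    let ?c = "residual (sup (a * x) b) x"
    have "?c * x * y \<le> sup (a * x) b * y"
      by (intro mult_lattice_mono residual_mult_le order_refl)
    then have "?c \<le> residual (sup (a * (x * y)) (b * y)) (x * y)"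
      by (simp add: le_residual_iff sup_mult_distrib mult.assoc)
    also have "\<dots> = sup a (residual (b * y) (x * y))"
      using z unfolding principal_element_def join_principal_def by blast
    also have "\<dots> \<le> sup a (residual b x)"
      by (intro sup_mono res order_refl)
    finally show "?c \<le> sup a (residual b x)" .
    show "sup a (residual b x) \<le> ?c"
      by (simp add: le_residual_iff sup_mult_distrib residual_mult_le le_supI2)
  qed
  ultimately show ?thesis
    by (simp add: principal_element_def meet_principal_def join_principal_def)
qed

lemma principal_prod_list_member:
  fixes a :: "'a::lattice_domain"
  assumes "principal_element (prod_list as)" "prod_list as \<noteq> bot" "a \<in> set as"
  shows "principal_element a \<and> a \<noteq> bot"
proof -
  obtain us vs where "as = us @ a # vs"
    using split_list[OF assms(3)] by blast
  then have "prod_list as = a * (prod_list us * prod_list vs)"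
    by (simp add: ac_simps)
  with assms show ?thesis
    using principal_factor[of a] by (auto simp: mult_eq_bot_iff)
qed

section \<open>CPP-factorizations give prime factorizations\<close>

text \<open>Write \<open>q = r * p\<close>. If \<open>q \<noteq> p\<close>, primality of \<open>q\<close> forces \<open>r \<le> q\<close>, so \<open>q \<le> q * p\<close>, and
  cancelling \<open>q\<close> gives \<open>p = 1\<close>.\<close>

lemma principal_prime_minimal:
  fixes p :: "'a::lattice_domain"
  assumes p: "principal_element p" "prime_element p"
    and q: "principal_element q" "prime_element q" "q \<noteq> bot" and "q \<le> p"
  shows "q = p"
proof (rule ccontr)
  assume "q \<noteq> p"
  define r where "r = residual q p"
  have q_eq: "q = r * p"
    using meet_principal_divides \<open>q \<le> p\<close> p(1) unfolding principal_element_def r_def by blast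
  with q(2) \<open>q \<noteq> p\<close> \<open>q \<le> p\<close> have "r \<le> q"
    unfolding prime_element_def by (metis order.antisym order_refl)
  then have "q * 1 \<le> q * p"
    using mult_lattice_mono[OF \<open>r \<le> q\<close> order_refl, of p] q_eq by simp
  then have "1 \<le> p"
    using cancellable_le[OF principal_cancellable[OF q(1,3)]] by blast
  then show False
    using p(2) le_one order.antisym unfolding prime_element_def by blast
qed

lemma principal_prime_of_power_member:
  fixes p :: "'a::lattice_domain"
  assumes "principal_element (prod_list as)" "prod_list as \<noteq> bot" "p ^ k \<in> set as" "k \<ge> 1"
  shows "principal_element p \<and> p \<noteq> bot"
proof -
  have "p ^ k = p * p ^ (k - 1)"
    using assms(4) by (simp flip: power_Suc)
  then show ?thesis
    using principal_prod_list_member[OF assms(1-3)] principal_factor[of p]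
    by (auto simp: mult_eq_bot_iff)
qed

text \<open>Dividing the CPP-factorization of \<open>p * a\<close> by \<open>p\<close> writes \<open>a\<close> as a product of elements
  comaximal to \<open>p\<close>.\<close>

lemma cpp_principal_prime_comaximal:
  fixes p :: "'a::lattice_domain"
  assumes p: "principal_element p" "prime_element p" "p \<noteq> bot"
    and a: "principal_element a" "\<not> a \<le> p"
    and cpp: "cpp_factorization as (p * a)"
  shows "comaximal a p"
proof -
  have "a \<noteq> bot"
    using a(2) by auto
  have nz: "p * a \<noteq> bot"
    using p(3) \<open>a \<noteq> bot\<close> by (simp add: mult_eq_bot_iff)
  have prod: "p * a = prod_list as" and sorted: "sorted_wrt comaximal as"
    and powers: "\<And>b. b \<in> set as \<Longrightarrow> \<exists>q k. prime_element q \<and> k \<ge> 1 \<and> b = q ^ k"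
    using cpp unfolding cpp_factorization_def by auto
  have pr: "principal_element (prod_list as)" "prod_list as \<noteq> bot"
    using principal_mult[OF p(1) a(1)] nz prod by auto
  have "prod_list as \<le> p"
    using prod mult_le_left by metis
  then obtain b where b: "b \<in> set as" "b \<le> p"
    using prime_prod_list_le[OF p(2)] by blast
  obtain q k where q: "prime_element q" "k \<ge> 1" "b = q ^ k"
    using powers b(1) by blast
  have "q \<le> p"
    using prime_power_le[OF p(2)] b(2) q(3) by blast
  then have "q = p"
    using principal_prime_minimal[OF p(1,2) _ q(1)]
      principal_prime_of_power_member[OF pr] b(1) q(2,3) by blast
  obtain us vs where as: "as = us @ b # vs"
    using split_list[OF b(1)] by blast
  define r where "r = prod_list (us @ vs)"
  have "p * a = p * (p ^ (k - 1) * r)"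
    using prod q(2,3) \<open>q = p\<close> unfolding as r_def
    by (cases k) (simp_all add: ac_simps)
  then have a_eq: "a = p ^ (k - 1) * r"
    by (rule cancellable_eq[OF principal_cancellable[OF p(1,3)]])
  have "k = 1"
  proof (rule ccontr)
    assume "k \<noteq> 1"
    then have "p ^ (k - 1) \<le> p"
      using q(2) mult_le_left by (cases "k - 1") auto
    then show False
      using a(2) a_eq mult_le_left order.trans by metis
  qed
  then have "a = r" "b = p"
    using a_eq q(3) \<open>q = p\<close> by auto
  moreover have "comaximal u p" if "u \<in> set (us @ vs)" for u
    using that sorted \<open>b = p\<close> unfolding as
    by (auto simp: sorted_wrt_append intro: comaximal_sym)
  ultimately show ?thesis
    unfolding r_def using comaximal_prod_list by blast
qed

lemma cpp_principal_prime_maximal: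
  fixes p :: "'a::lattice_domain"
  assumes gen: "generating {x::'a. principal_element x}"
    and cpp: "\<And>x::'a. principal_element x \<Longrightarrow> x \<noteq> bot \<Longrightarrow> x \<noteq> 1 \<Longrightarrow> \<exists>as. cpp_factorization as x"
    and p: "principal_element p" "prime_element p" "p \<noteq> bot"
  shows "maximal_element p"
proof (rule maximal_element_generators[OF gen])
  show "p \<noteq> 1"
    using p(2) unfolding prime_element_def by blast
  fix a assume "a \<in> {x. principal_element x}" and a: "\<not> a \<le> p"
  then have pa: "principal_element a"
    by simp
  have "p * a \<noteq> bot"
    using p(3) a by (auto simp: mult_eq_bot_iff)
  moreover have "p * a \<noteq> 1"
    using mult_le_left[of p a] le_one[of p] \<open>p \<noteq> 1\<close> by auto
  ultimately show "comaximal a p"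
    using cpp[OF principal_mult[OF p(1) pa]] cpp_principal_prime_comaximal[OF p pa a] by blast
qed

text \<open>An element not below any of the maximal elements is comaximal to all of them, hence to
  their product, and so equals \<open>1\<close>. Otherwise one of them is a factor of the element, and
  the complementary residual lies above the product of the others.\<close>

lemma prime_product_above_maximals:
  fixes a :: "'a::multiplicative_lattice"
  assumes "\<And>p. p \<in> set ps \<Longrightarrow> maximal_element p \<and> meet_principal p \<and> prime_element p"
    and "prod_list ps \<le> a"
  shows "\<exists>qs. (\<forall>q\<in>set qs. prime_element q) \<and> a = prod_list qs"
  using assms
proof (induction "length ps" arbitrary: ps a)
  case 0
  then have "a = 1"
    using le_one order.antisym by auto
  then show ?case
    by (intro exI[of _ "[]"]) simp
next
  case (Suc n)
  show ?case
  proof (cases "\<exists>p\<in>set ps. a \<le> p")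
    case True
    then obtain p where p: "p \<in> set ps" "a \<le> p"
      by blast
    then obtain us vs where ps: "ps = us @ p # vs"
      using split_list by metis
    have "prod_list (us @ vs) * p \<le> a"
      using Suc.prems(2) unfolding ps by (simp add: ac_simps)
    then have "prod_list (us @ vs) \<le> residual a p"
      by (simp add: le_residual_iff)
    then have "\<exists>qs. (\<forall>q\<in>set qs. prime_element q) \<and> residual a p = prod_list qs"
      using Suc.hyps(2) Suc.prems(1) unfolding ps by (intro Suc.hyps(1)[of "us @ vs"]) auto
    then obtain qs where "\<forall>q\<in>set qs. prime_element q" "residual a p = prod_list qs"
      by blast
    moreover have "a = residual a p * p"
      using meet_principal_divides p Suc.prems(1) by blast
    ultimately show ?thesis
      using Suc.prems(1)[OF p(1)] by (intro exI[of _ "p # qs"]) (auto simp: mult.commute)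
  next
    case False
    then have "comaximal p a" if "p \<in> set ps" for p
      using Suc.prems(1)[OF that] that comaximal_sym unfolding maximal_element_def by blast
    then have "comaximal (prod_list ps) a"
      by (rule comaximal_prod_list)
    then have "a = 1"
      using Suc.prems(2) by (simp add: comaximal_def sup_absorb2)
    then show ?thesis
      by (intro exI[of _ "[]"]) simp
  qed
qed

lemma cpp_prime_factorization:
  fixes a :: "'a::lattice_domain"
  assumes gen: "generating {x::'a. principal_element x}"
    and cpp: "\<And>x::'a. principal_element x \<Longrightarrow> x \<noteq> bot \<Longrightarrow> x \<noteq> 1 \<Longrightarrow> \<exists>as. cpp_factorization as x"
  shows "\<exists>ps. (\<forall>p\<in>set ps. prime_element p) \<and> a = prod_list ps"
proof -
  consider "a = bot" | "a = 1" | "a \<noteq> bot" "a \<noteq> 1"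
    by blast
  then show ?thesis
  proof cases
    case 1
    then show ?thesis
      by (intro exI[of _ "[bot]"]) (simp add: prime_bot)
  next
    case 2
    then show ?thesis
      by (intro exI[of _ "[]"]) simp
  next
    case 3
    obtain S where S: "S \<subseteq> {x. principal_element x}" "a = Sup S"
      using gen unfolding generating_def by blast
    then obtain x where x: "x \<in> S" "x \<noteq> bot"
      using 3(1) by (metis Sup_bot_conv(1))
    then have "x \<le> a" and px: "principal_element x"
      using S by (auto intro: Sup_upper)
    moreover have "x \<noteq> 1"
      using \<open>x \<le> a\<close> 3(2) le_one order.antisym by blast
    ultimately obtain as where "cpp_factorization as x"
      using cpp x(2) by blast
    then have as: "x = prod_list as"
      and powers: "\<forall>b\<in>set as. \<exists>q k. prime_element q \<and> k \<ge> 1 \<and> b = q ^ k"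
      unfolding cpp_factorization_def by auto
    from powers obtain q k
      where qk: "\<And>b. b \<in> set as \<Longrightarrow> prime_element (q b) \<and> k b \<ge> (1::nat) \<and> b = q b ^ k b"
      by metis
    define ps where "ps = concat (map (\<lambda>b. replicate (k b) (q b)) as)"
    have "prod_list (concat (map (\<lambda>b. replicate (k b) (q b)) bs)) = prod_list bs"
      if "set bs \<subseteq> set as" for bs
      using that qk by (induction bs) (auto simp: prod_list_replicate)
    then have "prod_list ps \<le> a"
      using \<open>x \<le> a\<close> as unfolding ps_def by simp
    moreover have "maximal_element p \<and> meet_principal p \<and> prime_element p"
      if p_in: "p \<in> set ps" for p
    proof -
      obtain b where b: "b \<in> set as" "p = q b"
        using p_in unfolding ps_def by (auto split: if_splits)
      then have "principal_element p" "p \<noteq> bot" "prime_element p"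
        using principal_prime_of_power_member[of as p "k b"] qk[OF b(1)] px x(2) as by auto
      then show ?thesis
        using cpp_principal_prime_maximal[OF gen cpp] unfolding principal_element_def by blast
    qed
    ultimately show ?thesis
      by (rule prime_product_above_maximals[rotated])
  qed
qed

section \<open>Dedekind lattices have CPP-factorizations\<close>

text \<open>Uniqueness of prime factorizations modulo \<open>p\<close>. A minimal factor \<open>Q\<close> on the left contains
  a factor on the right, which contains a factor on the left; by minimality all three are
  equal, and \<open>Q\<close> can be cancelled.\<close>

lemma prime_factorization_unique_mod:
  fixes p :: "'a::multiplicative_lattice"
  assumes "sup (prod_mset A) p = sup (prod_mset B) p"
    and "\<And>q. q \<in># A \<Longrightarrow> prime_element q \<and> p \<le> q \<and> cancellable_mod p q"
    and "\<And>q. q \<in># B \<Longrightarrow> prime_element q \<and> p \<le> q"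
  shows "A = B"
  using assms
proof (induction "size A" arbitrary: A B)
  case 0
  have "B = {#}"
  proof (rule ccontr)
    assume "B \<noteq> {#}"
    then obtain q where q: "q \<in># B"
      by blast
    then have "sup (prod_mset B) p \<le> q"
      using 0(4) prod_mset_le_member by auto
    then show False
      using 0(1,2,4) q le_one order.antisym unfolding prime_element_def
      by (metis le_sup_iff prod_mset_empty size_eq_0_iff_empty)
  qed
  then show ?case
    using 0 by simp
next
  case (Suc n)
  have "finite (set_mset A)" "set_mset A \<noteq> {}"
    using Suc.hyps(2) by auto
  then obtain Q where Q: "Q \<in># A" and min: "\<And>q. q \<in># A \<Longrightarrow> q \<le> Q \<Longrightarrow> q = Q"
    using finite_has_minimal[of "set_mset A"] by metis
  have "prod_mset B \<le> Q"
    using Suc.prems(1,2) Q prod_mset_le_member by (metis le_sup_iff)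
  then obtain R where R: "R \<in># B" "R \<le> Q"
    using prime_prod_mset_le Suc.prems(2) Q by blast
  have "prod_mset A \<le> R"
    using Suc.prems(1,3) R(1) prod_mset_le_member by (metis le_sup_iff)
  then obtain Q' where "Q' \<in># A" "Q' \<le> R"
    using prime_prod_mset_le Suc.prems(3) R(1) by blast
  then have "R = Q"
    using min R(2) order.antisym order.trans by metis
  obtain A' B' where A: "A = add_mset Q A'" and B: "B = add_mset Q B'"
    using multi_member_split Q R(1) \<open>R = Q\<close> by metis
  have "sup (Q * prod_mset A') p = sup (Q * prod_mset B') p"
    using Suc.prems(1) unfolding A B by simp
  then have "prod_mset A' \<le> sup (prod_mset B') p" "prod_mset B' \<le> sup (prod_mset A') p"
    using cancellable_modD[of p Q] Suc.prems(2)[OF Q] by (metis sup_ge1)+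
  then have "sup (prod_mset A') p = sup (prod_mset B') p"
    by (simp add: order.antisym)
  then have "A' = B'"
    using Suc.hyps Suc.prems(2,3) unfolding A B by auto
  then show ?case
    by (simp add: A B)
qed

lemma sup_square_mod:
  fixes p :: "'a::multiplicative_lattice"
  shows "sup (sup p a * sup p a) p = sup p (a * a)"
  by (rule order.antisym)
    (auto simp: mult_sup_distrib sup_mult_distrib mult_le_left mult_le_right le_supI1 le_supI2)

lemma dedekind_sup_square:
  fixes p :: "'a::multiplicative_lattice"
  assumes fact: "\<And>x::'a. \<exists>ps. (\<forall>p\<in>set ps. prime_element p) \<and> x = prod_list ps"
    and p: "prime_element p" and a: "join_principal a" "\<not> a \<le> p"
  shows "sup p (a * a) = sup p a * sup p a"
proof -
  obtain As where As: "\<forall>q\<in>#As. prime_element q" "sup p a = prod_mset As"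
    using fact[of "sup p a"] by (metis prod_mset_prod_list set_mset_mset)
  obtain Bs where Bs: "\<forall>q\<in>#Bs. prime_element q" "sup p (a * a) = prod_mset Bs"
    using fact[of "sup p (a * a)"] by (metis prod_mset_prod_list set_mset_mset)
  have ca: "cancellable_mod p a"
    using join_principal_cancellable_mod[OF a(1) p a(2)] .
  have "As + As = Bs"
  proof (rule prime_factorization_unique_mod)
    show "sup (prod_mset (As + As)) p = sup (prod_mset Bs) p"
      using sup_square_mod[of p a] by (simp flip: As(2) Bs(2) add: sup.absorb1)
  next
    fix q assume "q \<in># As + As"
    then have q: "q \<in># As"
      by simp
    then have "p \<le> q"
      using prod_mset_le_member[OF q] As(2) by (metis le_sup_iff)
    obtain As' where "As = add_mset q As'"
      using multi_member_split[OF q] by blast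
    then have "sup (q * prod_mset As') p = sup a p"
      using As(2)[symmetric] by (simp add: sup_aci)
    then have "cancellable_mod p q"
      by (rule cancellable_mod_factor[OF ca])
    then show "prime_element q \<and> p \<le> q \<and> cancellable_mod p q"
      using \<open>p \<le> q\<close> As(1) q by blast
  next
    fix q assume q: "q \<in># Bs"
    then show "prime_element q \<and> p \<le> q"
      using prod_mset_le_member[OF q] Bs by (metis le_sup_iff)
  qed
  then show ?thesis
    using As(2) Bs(2) by auto
qed

text \<open>From \<open>p \<le> sup (p * p) a\<close>, taking residuals by \<open>p\<close> gives \<open>sup p (residual a p) = 1\<close>. Here
  \<open>residual a p \<le> a\<close>: the element \<open>residual a p * p\<close> is below both \<open>a\<close> and \<open>p\<close>, hence a
  multiple \<open>t * a\<close> with \<open>t \<le> p\<close>, and \<open>p\<close> can be cancelled.\<close>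

lemma dedekind_principal_prime_comaximal:
  fixes p :: "'a::lattice_domain"
  assumes fact: "\<And>x::'a. \<exists>ps. (\<forall>p\<in>set ps. prime_element p) \<and> x = prod_list ps"
    and p: "principal_element p" "prime_element p" "p \<noteq> bot"
    and a: "principal_element a" "\<not> a \<le> p"
  shows "comaximal a p"
proof -
  have "p \<le> sup p a * sup p a"
    using dedekind_sup_square[OF fact p(2) _ a(2)] a(1) unfolding principal_element_def
    by (metis sup_ge1)
  also have "\<dots> \<le> sup (p * p) a"
    by (auto simp: mult_sup_distrib sup_mult_distrib mult_le_left mult_le_right le_supI1 le_supI2)
  finally have "1 \<le> residual (sup (p * p) a) p"
    by (simp add: le_residual_iff)
  also have "\<dots> = sup p (residual a p)"
    using p(1) unfolding principal_element_def join_principal_def by blast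
  also have "\<dots> \<le> sup p a"
  proof -
    define t where "t = residual (residual a p * p) a"
    have ta: "residual a p * p = t * a"
      unfolding t_def using meet_principal_divides a(1) residual_mult_le
      unfolding principal_element_def by blast
    then have "t * a \<le> p"
      using mult_le_right by metis
    then have "t \<le> p"
      using p(2) a(2) unfolding prime_element_def by blast
    then have "p * residual a p \<le> p * a"
      using ta mult_lattice_mono[of t p a a] by (simp add: mult.commute)
    then have "residual a p \<le> a"
      by (rule cancellable_le[OF principal_cancellable[OF p(1,3)]])
    then show ?thesis
      by (rule sup_mono[OF order_refl])
  qed
  finally show ?thesis
    unfolding comaximal_def using le_one order.antisym by (metis sup_commute)
qed

lemma cpp_factorization_of_maximals:
  fixes ps :: "'a::multiplicative_lattice list"
  assumes "prod_list ps \<noteq> 1"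
    and ps: "\<And>p. p \<in> set ps \<Longrightarrow> prime_element p \<and> maximal_element p"
  shows "\<exists>as. cpp_factorization as (prod_list ps)"
proof -
  define as where "as = map (\<lambda>p. p ^ count_list ps p) (remdups ps)"
  have prod: "prod_list ps = prod_list as"
  proof -
    have "prod_list ps = (\<Prod>p\<in>set ps. p ^ count_list ps p)"
      using prod_mset_multiplicity[of "mset ps"] by (simp add: prod_mset_prod_list count_mset)
    also have "\<dots> = prod_list as"
      unfolding as_def by (simp add: prod.distinct_set_conv_list[symmetric])
    finally show ?thesis .
  qed
  have comax: "comaximal p q" if "p \<in> set ps" "q \<in> set ps" "p \<noteq> q" for p q
  proof -
    have "\<not> p \<le> q"
      using that ps maximal_element_eq unfolding maximal_element_def by metis
    then show ?thesis
      using ps that unfolding maximal_element_def by blast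
  qed
  have "sorted_wrt comaximal as"
    unfolding as_def
  proof (rule sorted_wrt_map_mono)
    show "sorted_wrt (\<noteq>) (remdups ps)"
      by (simp add: sorted_wrt_iff_nth_less nth_eq_iff_index_eq)
  qed (simp add: comax comaximal_powers)
  moreover have "p ^ count_list ps p \<noteq> 1 \<and> count_list ps p \<ge> 1" if "p \<in> set ps" for p
  proof -
    have "count_list ps p \<ge> 1"
      using that by (simp add: Suc_le_eq count_list_0_iff flip: neq0_conv)
    then have "p ^ count_list ps p \<le> p"
      using mult_le_left by (cases "count_list ps p") auto
    then show ?thesis
      using \<open>count_list ps p \<ge> 1\<close> ps[OF that] le_one order.antisym
      unfolding prime_element_def by metis
  qed
  moreover have "as \<noteq> []"
    using prod assms(1) by auto
  ultimately have "cpp_factorization as (prod_list ps)"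
    unfolding cpp_factorization_def using prod ps by (auto simp: as_def)
  then show ?thesis
    by blast
qed

lemma dedekind_cpp_factorization:
  fixes x :: "'a::lattice_domain"
  assumes gen: "generating {x::'a. principal_element x}"
    and fact: "\<And>x::'a. \<exists>ps. (\<forall>p\<in>set ps. prime_element p) \<and> x = prod_list ps"
    and x: "principal_element x" "x \<noteq> bot" "x \<noteq> 1"
  shows "\<exists>as. cpp_factorization as x"
proof -
  obtain ps where ps: "\<forall>p\<in>set ps. prime_element p" "x = prod_list ps"
    using fact by blast
  have "maximal_element p" if "p \<in> set ps" for p
  proof (rule maximal_element_generators[OF gen])
    have p: "principal_element p" "p \<noteq> bot" "prime_element p"
      using principal_prod_list_member[of ps p] that x ps by auto
    then show "p \<noteq> 1"
      unfolding prime_element_def by blast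
    show "comaximal a p" if "a \<in> {x. principal_element x}" "\<not> a \<le> p" for a
      using dedekind_principal_prime_comaximal[OF fact p(1,3,2)] that by blast
  qed
  then show ?thesis
    using cpp_factorization_of_maximals[of ps] ps x(3) by blast
qed

section \<open>The characterization\<close>

theorem theorem23:
  assumes "generating {x::'a::lattice_domain. principal_element x}"
  shows "dedekind_lattice TYPE('a) \<longleftrightarrow>
    (\<forall>x::'a. principal_element x \<and> x \<noteq> bot \<and> x \<noteq> 1 \<longrightarrow> (\<exists>as. cpp_factorization as x))"
proof
  assume "dedekind_lattice TYPE('a)"
  then show "\<forall>x::'a. principal_element x \<and> x \<noteq> bot \<and> x \<noteq> 1 \<longrightarrow> (\<exists>as. cpp_factorization as x)"
    using dedekind_cpp_factorization[OF assms] unfolding dedekind_lattice_def by blast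
next
  assume "\<forall>x::'a. principal_element x \<and> x \<noteq> bot \<and> x \<noteq> 1 \<longrightarrow> (\<exists>as. cpp_factorization as x)"
  then show "dedekind_lattice TYPE('a)"
    unfolding dedekind_lattice_def using cpp_prime_factorization[OF assms] assms by blast
qed

end
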